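(* Let $n\ge1$. For $\lambda=(\lambda_0,\lambda_1,\dots,\lambda_{2n})\in\mathbb{R}^{2n+1}$ let $K(\lambda)$ be the $(n+1)\times(n+1)$ Hankel matrix with entries $K(\lambda)_{jk}=\lambda_{j+k}$, $0\le j,k\le n$. The even compact moment curve $$\bigl\{(\cos^{2n}\theta,\ \cos^{2n-1}\theta\sin\theta,\ \cos^{2n-2}\theta\sin^2\theta,\ \dots,\ \sin^{2n}\theta):\theta\in[0,2\pi)\bigr\}\subset\mathbb{R}^{2n+1}$$ consists of all vectors $\lambda\in\mathbb{R}^{2n+1}$ such that $K(\lambda)$ has rank one, is positive semidefinite, and satisfies the linear equation $$\sum_{j=0}^n\binom nj\lambda_{2j}=1.$$ The convex hull of this curve consists of all $\lambda\in\mathbb{R}^{2n+1}$ such that $K(\lambda)$ is positive semidefinite and $\sum_{j=0}^n\binom nj\lambda_{2j}=1$.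
   Context: The curve is the image of the unit circle under the degree $2n$ moment map $(x,y)\mapsto(x^{2n},x^{2n-1}y,\dots,y^{2n})$. *)

theory Defs
  imports Complex_Main "HOL.Hull" "Jordan_Normal_Form.DL_Rank"
begin

text \<open>
  Vectors of \<open>\<real>\<^sup>d\<close> are elements of \<open>carrier_vec d\<close>, so that the dimension is an ordinary natural number.
\<close>

definition hankel_mat :: "nat \<Rightarrow> real vec \<Rightarrow> real mat" where
  "hankel_mat n l = mat (n + 1) (n + 1) (\<lambda>(j, k). l $ (j + k))"

definition positive_semidefinite :: "real mat \<Rightarrow> bool" where
  "positive_semidefinite A \<longleftrightarrow>
     square_mat A \<and> transpose_mat A = A \<and>
     (\<forall>x \<in> carrier_vec (dim_row A). x \<bullet> (A *\<^sub>v x) \<ge> 0)"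

definition moment_map :: "nat \<Rightarrow> real \<Rightarrow> real \<Rightarrow> real vec" where
  "moment_map d x y = vec (d + 1) (\<lambda>i. x ^ (d - i) * y ^ i)"

definition even_moment_curve :: "nat \<Rightarrow> real vec set" where
  "even_moment_curve n = {moment_map (2 * n) (cos t) (sin t) | t. t \<in> {0..<2 * pi}}"

text \<open>
  The type \<^typ>\<open>real vec\<close> mixes all dimensions and is no instance of \<open>real_vector\<close>, so \<open>convex\<close> from
  HOL-Analysis does not apply to it. The definition below transcribes that one to \<open>\<real>\<^sup>d\<close>;
  as there, the convex hull is the least convex superset, in terms of the generic \<^const>\<open>hull\<close>.
\<close>

definition convex_vec :: "nat \<Rightarrow> real vec set \<Rightarrow> bool" where
  "convex_vec d C \<longleftrightarrow>
     C \<subseteq> carrier_vec d \<and>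
     (\<forall>x \<in> C. \<forall>y \<in> C. \<forall>u \<ge> 0. \<forall>v \<ge> 0. u + v = 1 \<longrightarrow> u \<cdot>\<^sub>v x + v \<cdot>\<^sub>v y \<in> C)"

end

theory Submission
  imports Defs "HOL-Computational_Algebra.Fundamental_Theorem_Algebra"
    "Jordan_Normal_Form.DL_Rank_Submatrix"
begin

text \<open>
  Every point \<open>(x\<^sup>2\<^sup>n, x\<^sup>2\<^sup>n\<^sup>-\<^sup>1 y, \<dots>, y\<^sup>2\<^sup>n)\<close> has as Hankel matrix the outer product of the vector
  \<open>(x\<^sup>n, x\<^sup>n\<^sup>-\<^sup>1 y, \<dots>, y\<^sup>n)\<close> with itself, and by the binomial theorem the linear form of the statement
  takes the value \<open>(x\<^sup>2 + y\<^sup>2)\<^sup>n\<close> there. Hence the curve satisfies all the stated conditions, and so does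
  its convex hull, except for the rank. It remains to prove the two converses.

  If the Hankel matrix has rank one, its \<open>2 \<times> 2\<close> minors vanish. When \<open>l\<^sub>0 \<noteq> 0\<close>, they force \<open>l\<close> to be
  a geometric progression \<open>l\<^sub>i = l\<^sub>0 r\<^sup>i\<close>; when \<open>l\<^sub>0 = 0\<close>, they force all entries but the last one
  to vanish. The linear equation fixes the remaining scalar, and the result is the
  point of the curve over \<open>(1, r) / sqrt (1 + r\<^sup>2)\<close> or over \<open>(0, 1)\<close>
  (\<open>rank_one_hankel_in_curve\<close>).

  If the Hankel matrix is positive semidefinite, read \<open>l\<close> as the linear functional
  \<open>L t\<^sup>i = l\<^sub>i\<close> on real polynomials of degree at most \<open>2n\<close>. Semidefiniteness says \<open>L (p\<^sup>2) \<ge> 0\<close> for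
  \<open>degree p \<le> n\<close>, and the claim becomes a Gauss quadrature formula
  \<open>L p = (\<Sum>r\<in>R. w r * p(r)) + c * coeff p (2n)\<close> with \<open>w r \<ge> 0\<close> and \<open>c \<ge> 0\<close>, whose last term
  is evaluation at infinity (\<open>quadrature\<close>).
  The nodes are the roots of a monic polynomial \<open>h\<close> of least degree at which \<open>L\<close> stops being definite
  or, if that does not happen below degree \<open>n\<close>, of the \<open>n\<close>-th orthogonal polynomial. In both cases
  \<open>L (h q) = 0\<close> as soon as \<open>degree (h q) < 2n\<close> (\<open>exists_orthogonal_monic\<close>), and then definiteness
  below \<open>degree h\<close> leaves no room for multiple or non-real roots
  (\<open>orthogonal_has_simple_real_roots\<close>). Evaluated at the monomials, the formula writes \<open>l\<close> as a
  combination of points of the curve with nonnegative weights, and the linear equation, which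
  holds for \<open>l\<close> and for every point of the curve, says that the weights add up to one.
\<close>

section \<open>Division, real roots and interpolation\<close>

lemma degree_div_le_diff:
  fixes p q :: "'a::field poly"
  assumes "degree p \<le> m + degree q"
  shows "degree (p div q) \<le> m"
proof (cases "p div q = 0")
  case False
  then have "q \<noteq> 0" by auto
  have "degree q + degree (p div q) = degree (p - p mod q)"
    using False \<open>q \<noteq> 0\<close> by (simp add: degree_mult_eq minus_mod_eq_mult_div)
  also have "\<dots> \<le> max (degree p) (degree (p mod q))" by (rule degree_diff_le_max)
  finally show ?thesis using assms degree_mod_less[OF \<open>q \<noteq> 0\<close>, of p] by auto
qed simp

text \<open>
  The excluded divisors are \<open>(t - a)\<^sup>2 + b\<^sup>2\<close>: for \<open>b \<noteq> 0\<close> they rule out a conjugate pair of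
  non-real roots, and for \<open>b = 0\<close> a double real root. So each complex root given by the fundamental
  theorem of algebra is real and can be split off as a simple factor.
\<close>

lemma card_real_roots_eq_degree:
  fixes h :: "real poly"
  assumes "h \<noteq> 0" and "\<And>a b. \<not> [:a^2 + b^2, - 2 * a, 1:] dvd h"
  shows "card {x. poly h x = 0} = degree h"
  using assms
proof (induction "degree h" arbitrary: h)
  case 0
  then obtain c where "h = [:c:]" "c \<noteq> 0" by (metis degree_eq_zeroE pCons_0_0)
  then show ?case by simp
next
  case (Suc d)
  have eval_add: "poly (map_poly complex_of_real (p + q)) z =
      poly (map_poly complex_of_real p) z + poly (map_poly complex_of_real q) z" for p q z
  proof -
    have "map_poly complex_of_real (p + q) = map_poly complex_of_real p + map_poly complex_of_real q"
      by (rule poly_eqI) (simp add: coeff_map_poly)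
    then show ?thesis by simp
  qed
  have eval_mult: "poly (map_poly complex_of_real (p * q)) z =
      poly (map_poly complex_of_real p) z * poly (map_poly complex_of_real q) z" for p q z
    by (induction p) (simp_all add: map_poly_pCons map_poly_smult eval_add algebra_simps)
  have "\<not> constant (poly (map_poly complex_of_real h))"
    using Suc.hyps(2) by (simp add: constant_degree degree_map_poly)
  then obtain z where z: "poly (map_poly complex_of_real h) z = 0"
    using fundamental_theorem_of_algebra by blast
  define q where "q = [:(Re z)^2 + (Im z)^2, - 2 * Re z, 1:]"
  \<comment> \<open>The remainder of \<open>h\<close> by \<open>q = (t - z) (t - cnj z)\<close> is real, of degree at most one, and vanishes at \<open>z\<close>.\<close>
  have "degree (h mod q) < 2"
    using degree_mod_less[of q h] by (auto simp: q_def)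
  then obtain a b where ab: "h mod q = [:a, b:]"
    by (intro that[of "coeff (h mod q) 0" "coeff (h mod q) 1"] poly_eqI)
      (auto simp: coeff_eq_0 coeff_pCons less_2_cases_iff numeral_2_eq_2 split: nat.splits)
  have "poly (map_poly complex_of_real q) z = 0"
    by (simp add: q_def map_poly_pCons complex_eq_iff power2_eq_square algebra_simps)
  moreover have "h = q * (h div q) + h mod q" by simp
  ultimately have "poly (map_poly complex_of_real (h mod q)) z = 0"
    using z eval_mult[of q "h div q" z] eval_add[of "q * (h div q)" "h mod q" z] by simp
  then have "a + b * Re z = 0" "b * Im z = 0"
    unfolding ab by (simp_all add: map_poly_pCons complex_eq_iff mult.commute)
  moreover have "\<not> q dvd h" using Suc.prems(2) by (simp add: q_def)
  then have "[:a, b:] \<noteq> 0" using ab by (metis dvd_eq_mod_eq_0)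
  ultimately have "Im z = 0" by auto
  then have z_real: "z = complex_of_real (Re z)" by (simp add: complex_eq_iff)
  have "poly (map_poly complex_of_real p) (complex_of_real x) = complex_of_real (poly p x)" for p x
    by (induction p) (simp_all add: map_poly_pCons)
  then have "poly h (Re z) = 0" using z z_real by (metis of_real_eq_0_iff)
  then obtain g where g: "h = [:- Re z, 1:] * g" by (auto simp: poly_eq_0_iff_dvd)
  have g0: "g \<noteq> 0" using g Suc.prems(1) by auto
  have dg: "d = degree g" using g g0 Suc.hyps(2) degree_mult_eq[of "[:- Re z, 1:]" g] by simp
  have "\<not> [:u^2 + v^2, - 2 * u, 1:] dvd g" for u v
    using Suc.prems(2)[of u v] g dvd_mult by blast
  then have IH: "card {x. poly g x = 0} = degree g" using Suc.hyps(1)[OF dg] g0 by blast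
  have "poly g (Re z) \<noteq> 0"
  proof
    assume "poly g (Re z) = 0"
    then obtain k where k: "g = [:- Re z, 1:] * k" by (auto simp: poly_eq_0_iff_dvd)
    have "h = ([:- Re z, 1:] * [:- Re z, 1:]) * k" by (simp only: g k mult.assoc)
    also have "[:- Re z, 1:] * [:- Re z, 1:] = [:(Re z)^2 + 0^2, - 2 * Re z, 1:]"
      by (simp add: power2_eq_square)
    finally have "h = [:(Re z)^2 + 0^2, - 2 * Re z, 1:] * k" .
    then show False using Suc.prems(2)[of "Re z" 0] by (metis dvd_triv_left)
  qed
  moreover have "{x. poly h x = 0} = insert (Re z) {x. poly g x = 0}"
    by (auto simp: g)
  moreover have "finite {x. poly g x = 0}" using g0 by (rule poly_roots_finite)
  ultimately show ?case using IH dg Suc.hyps(2) by simp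
qed

lemma lagrange_interpolation_basis:
  fixes R :: "'a::field set"
  assumes "finite R"
  obtains l where "\<And>r. r \<in> R \<Longrightarrow> degree (l r) < card R"
    and "\<And>r s. r \<in> R \<Longrightarrow> s \<in> R \<Longrightarrow> poly (l r) s = (if s = r then 1 else 0)"
proof
  define P where "P r = (\<Prod>s\<in>R - {r}. [:- s, 1:])" for r
  fix r assume r: "r \<in> R"
  have "degree (P r) = card R - 1"
    using assms r unfolding P_def by (subst degree_prod_eq_sum_degree) auto
  moreover have "0 < card R" using r assms by (auto simp: card_gt_0_iff)
  ultimately show "degree (smult (inverse (poly (P r) r)) (P r)) < card R"
    using le_less_trans[OF degree_smult_le] by fastforce
  fix s assume s: "s \<in> R"
  have "poly (P r) r \<noteq> 0" using assms by (simp add: P_def poly_prod)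
  moreover have "s \<noteq> r \<Longrightarrow> poly (P r) s = 0"
    using assms s unfolding P_def poly_prod by (intro prod_zero) auto
  ultimately show "poly (smult (inverse (poly (P r) r)) (P r)) s = (if s = r then 1 else 0)"
    by auto
qed

section \<open>Gauss quadrature for positive functionals\<close>

locale pos_functional =
  fixes L :: "real poly \<Rightarrow> real" and n :: nat
  assumes add: "L (p + q) = L p + L q"
    and smult: "L (smult a p) = a * L p"
    and nonneg: "degree p \<le> n \<Longrightarrow> 0 \<le> L (p * p)"
begin

lemma zero [simp]: "L 0 = 0" using smult[of 0 0] by simp
lemma diff: "L (p - q) = L p - L q" using add[of "p - q" q] by simp
lemma sum: "L (\<Sum>i\<in>I. f i) = (\<Sum>i\<in>I. L (f i))"
  by (induction I rule: infinite_finite_induct) (simp_all add: add)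

text \<open>
  The polynomials of degree less than \<open>d\<close> (including \<open>0\<close> when \<open>d = 0\<close>) are the \<open>q\<close> whose coefficients
  from index \<open>d\<close> on vanish. On them the form \<open>(p, q) \<mapsto> L (p q)\<close> is definite, so every \<open>p\<close> has an
  orthogonal projection \<open>r\<close>, which is built by one Gram-Schmidt step per degree.
\<close>

lemma orthogonal_projection:
  assumes "\<And>q. q \<noteq> 0 \<Longrightarrow> degree q < d \<Longrightarrow> 0 < L (q * q)"
  shows "\<exists>r. (\<forall>i\<ge>d. coeff r i = 0) \<and> (\<forall>q. (\<forall>i\<ge>d. coeff q i = 0) \<longrightarrow> L ((p - r) * q) = 0)"
  using assms
proof (induction d arbitrary: p)
  case 0
  have "q = 0" if "\<forall>i\<ge>0. coeff q i = 0" for q :: "real poly" using that by (simp add: poly_eq_iff)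
  then show ?case by (metis zero coeff_0 mult_zero_right)
next
  case (Suc d)
  note IH = Suc.IH[OF Suc.prems[OF _ less_SucI]]
  obtain r where r: "\<forall>i\<ge>d. coeff r i = 0"
    "\<And>q. \<forall>i\<ge>d. coeff q i = 0 \<Longrightarrow> L ((p - r) * q) = 0" using IH by blast
  \<comment> \<open>Apart from \<open>p\<close>, also the monomial \<open>t\<^sup>d\<close> is projected: this gives the new orthogonal basis vector \<open>h\<close>.\<close>
  obtain s where s: "\<forall>i\<ge>d. coeff s i = 0"
    "\<And>q. \<forall>i\<ge>d. coeff q i = 0 \<Longrightarrow> L ((monom 1 d - s) * q) = 0" using IH by blast
  define h where "h = monom 1 d - s"
  have h_coeff: "coeff h d = 1" "\<forall>i\<ge>Suc d. coeff h i = 0" using s(1) by (simp_all add: h_def)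
  have "h \<noteq> 0" "degree h < Suc d" using h_coeff by (auto intro!: degree_lessI)
  then have hh: "0 < L (h * h)" using Suc.prems by blast
  define c where "c = L ((p - r) * h) / L (h * h)"
  show ?case
  proof (intro exI[of _ "r + smult c h"] conjI allI impI)
    fix q :: "real poly" assume q: "\<forall>i\<ge>Suc d. coeff q i = 0"
    define a where "a = coeff q d"
    define q' where "q' = q - smult a h"
    have q': "\<forall>i\<ge>d. coeff q' i = 0"
    proof (intro allI impI)
      fix i assume "i \<ge> d"
      then show "coeff q' i = 0"
        using q h_coeff by (cases "i = d") (auto simp: q'_def a_def)
    qed
    have "(p - (r + smult c h)) * q =
        smult a ((p - r) * h) + (p - r) * q' - smult (c * a) (h * h) - smult c (h * q')"
      by (simp add: q'_def algebra_simps smult_diff_right)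
    then have "L ((p - (r + smult c h)) * q) =
        a * L ((p - r) * h) + L ((p - r) * q') - c * a * L (h * h) - c * L (h * q')"
      by (simp only: add diff smult)
    also have "\<dots> = a * (L ((p - r) * h) - c * L (h * h))"
      using r(2)[OF q'] s(2)[OF q', folded h_def] by (simp add: algebra_simps)
    also have "\<dots> = 0" using hh by (simp add: c_def)
    finally show "L ((p - (r + smult c h)) * q) = 0" .
  qed (use r(1) h_coeff in simp)
qed

text \<open>
  This is the degenerate case of the Cauchy-Schwarz inequality: the quadratic function
  \<open>s \<mapsto> L ((q + s p)\<^sup>2)\<close> is affine because \<open>L (p\<^sup>2) = 0\<close>, and bounded below, hence constant.
\<close>

lemma null_orthogonal:
  assumes "degree p \<le> n" "degree q \<le> n" "L (p * p) = 0"
  shows "L (p * q) = 0"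
proof (rule ccontr)
  assume ne: "L (p * q) \<noteq> 0"
  \<comment> \<open>The value of \<open>s\<close> at which the affine function equals \<open>-1\<close>.\<close>
  define s where "s = - (L (q * q) + 1) / (2 * L (p * q))"
  have "0 \<le> L ((q + smult s p) * (q + smult s p))"
    using assms by (intro nonneg degree_add_le) (auto intro: le_trans[OF degree_smult_le])
  also have "(q + smult s p) * (q + smult s p) = q * q + smult (s + s) (p * q) + smult (s^2) (p * p)"
    by (simp only: distrib_left distrib_right smult_add_left power2_eq_square
        mult_smult_left mult_smult_right smult_smult mult.commute add_ac)
  also have "L \<dots> = -1" using assms ne by (simp add: add smult s_def)
  finally show False by simp
qed

text \<open>
  If \<open>L\<close> is definite below degree \<open>n\<close>, then \<open>h\<close> is the \<open>n\<close>-th orthogonal polynomial. Otherwise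
  \<open>h\<close> is a null polynomial of least degree \<open>d < n\<close>. It is orthogonal to all polynomials of degree at
  most \<open>n\<close>, and this passes on from \<open>t\<^sup>k h\<close> to \<open>t\<^sup>k\<^sup>+\<^sup>1 h\<close> because
  \<open>L ((t\<^sup>k\<^sup>+\<^sup>1 h)\<^sup>2) = L (t\<^sup>k h \<cdot> t\<^sup>k\<^sup>+\<^sup>2 h)\<close>, which vanishes as long as
  \<open>t\<^sup>k\<^sup>+\<^sup>2 h\<close> has degree at most \<open>n\<close>. The last multiple so reached is \<open>t\<^sup>n\<^sup>-\<^sup>1\<^sup>-\<^sup>d h\<close>,
  so the products \<open>h q\<close> that are covered are exactly those of degree at most \<open>2n - 1\<close>.
\<close>

lemma exists_orthogonal_monic:
  "\<exists>h. lead_coeff h = 1 \<and> degree h \<le> n \<and>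
     (\<forall>q. q \<noteq> 0 \<longrightarrow> degree q < degree h \<longrightarrow> 0 < L (q * q)) \<and>
     (\<forall>q. degree (h * q) < 2 * n \<longrightarrow> L (h * q) = 0)"
proof (cases "\<exists>q. q \<noteq> 0 \<and> degree q < n \<and> L (q * q) \<le> 0")
  case False
  then have pos: "\<And>q. q \<noteq> 0 \<Longrightarrow> degree q < n \<Longrightarrow> 0 < L (q * q)" by fastforce
  obtain r where r: "\<forall>i\<ge>n. coeff r i = 0"
    "\<And>q. \<forall>i\<ge>n. coeff q i = 0 \<Longrightarrow> L ((monom 1 n - r) * q) = 0"
    using orthogonal_projection[OF pos] by blast
  define h where "h = monom 1 n - r"
  have hn: "coeff h n = 1" "\<forall>i>n. coeff h i = 0" using r(1) by (simp_all add: h_def)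
  then have deg: "degree h = n" by (intro antisym degree_le le_degree) auto
  have "L (h * q) = 0" if "degree (h * q) < 2 * n" for q
  proof (cases "q = 0")
    case False
    then have "degree q < n" using that deg hn degree_mult_eq[of h q] by fastforce
    then show ?thesis using r(2)[of q] by (simp add: h_def coeff_eq_0)
  qed simp
  then show ?thesis using deg hn pos by auto
next
  case True
  define bad where "bad q \<longleftrightarrow> q \<noteq> 0 \<and> degree q < n \<and> L (q * q) \<le> 0" for q
  obtain f where f: "bad f" and f_min: "\<And>q. bad q \<Longrightarrow> degree f \<le> degree q"
    using True ex_has_least_nat[of bad _ degree] unfolding bad_def by metis
  define d where "d = degree f"
  define h where "h = smult (inverse (lead_coeff f)) f"
  have f0: "f \<noteq> 0" "degree f < n" using f by (auto simp: bad_def)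
  have h: "lead_coeff h = 1" "degree h = d" "d < n" "h \<noteq> 0" using f0 by (auto simp: h_def d_def)
  have "L (f * f) = 0" using f nonneg[of f] by (auto simp: bad_def)
  then have hh: "L (h * h) = 0" by (simp add: h_def smult)
  have shift: "L (monom 1 k * h * q) = 0" if "d + k < n" "degree q \<le> n" for k q
    using that
  proof (induction k arbitrary: q)
    case 0
    have "monom 1 0 * h * q = h * q" by simp
    then show ?case using null_orthogonal[of h q] 0 h hh by simp
  next
    case (Suc k)
    have deg: "degree (monom 1 j * h) = d + j" for j
      using h by (simp add: degree_mult_eq degree_monom_eq)
    \<comment> \<open>The degree of the second factor is \<open>d + k + 2 \<le> n\<close>, since \<open>d + Suc k < n\<close>.\<close>
    have "L (monom 1 k * h * (monom 1 (Suc (Suc k)) * h)) = 0"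
      using Suc.prems by (intro Suc.IH) (auto simp: deg)
    also have "monom 1 k * h * (monom 1 (Suc (Suc k)) * h) = monom 1 (Suc k) * h * (monom 1 (Suc k) * h)"
    proof -
      have "monom 1 (Suc j) = monom 1 1 * monom (1::real) j" for j by (simp add: mult_monom)
      then show ?thesis by (simp only: mult_ac)
    qed
    finally have "L (monom 1 (Suc k) * h * (monom 1 (Suc k) * h)) = 0" .
    then show ?case using Suc.prems null_orthogonal[of "monom 1 (Suc k) * h" q] deg by simp
  qed
  have "L (h * q) = 0" if "degree (h * q) < 2 * n" for q
  proof (cases "q = 0")
    case False
    define k where "k = n - 1 - d"
    have k: "d + k = n - 1" "d + k < n" using h by (auto simp: k_def)
    have dq: "degree q \<le> n + k" using that False h k degree_mult_eq[of h q] by simp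
    \<comment> \<open>Splitting \<open>q\<close> at \<open>t\<^sup>k\<close> with the largest admissible \<open>k\<close> leaves two cofactors of degree at most \<open>n\<close>.\<close>
    define u where "u = q div monom 1 k"
    define v where "v = q mod monom 1 k"
    have q: "q = monom 1 k * u + v" by (simp add: u_def v_def)
    have "h * q = monom 1 k * h * u + monom 1 0 * h * v"
      unfolding q by (simp only: distrib_left mult_ac monom_eq_1 mult_1_right mult_1_left)
    then have "L (h * q) = L (monom 1 k * h * u) + L (monom 1 0 * h * v)"
      by (simp only: add)
    moreover have "degree u \<le> n"
      using dq unfolding u_def by (intro degree_div_le_diff) (simp add: degree_monom_eq)
    moreover have "degree v \<le> n"
      unfolding v_def using degree_mod_less[of "monom 1 k" q] k by (auto simp: degree_monom_eq)
    ultimately show ?thesis using k shift[of k u] shift[of 0 v] h by simp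
  qed simp
  moreover have "0 < L (q * q)" if "q \<noteq> 0" "degree q < degree h" for q
    using that h f_min[of q] by (force simp: bad_def d_def)
  ultimately show ?thesis using h by auto
qed

text \<open>
  If \<open>h = ((t - a)\<^sup>2 + b\<^sup>2) g\<close>, then \<open>0 = L (h g) = L (((t - a) g)\<^sup>2) + b\<^sup>2 L (g\<^sup>2)\<close>, although
  \<open>(t - a) g\<close> is nonzero of degree less than \<open>degree h\<close>, where \<open>L\<close> is definite.
\<close>

lemma orthogonal_has_simple_real_roots:
  assumes h: "lead_coeff h = 1" "degree h \<le> n"
    and pos: "\<And>q. q \<noteq> 0 \<Longrightarrow> degree q < degree h \<Longrightarrow> 0 < L (q * q)"
    and orth: "\<And>q. degree (h * q) < 2 * n \<Longrightarrow> L (h * q) = 0"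
  shows "card {x. poly h x = 0} = degree h"
proof (rule card_real_roots_eq_degree)
  show "h \<noteq> 0" using h(1) by auto
  fix a b
  show "\<not> [:a^2 + b^2, - 2 * a, 1:] dvd h"
  proof
    assume "[:a^2 + b^2, - 2 * a, 1:] dvd h"
    then obtain g where hg: "h = [:a^2 + b^2, - 2 * a, 1:] * g" by blast
    have g0: "g \<noteq> 0" using hg \<open>h \<noteq> 0\<close> by auto
    have dh: "degree h = degree g + 2"
      using g0 unfolding hg by (subst degree_mult_eq) auto
    have "[:a^2 + b^2, - 2 * a, 1:] = [:- a, 1:] * [:- a, 1:] + [:b^2:]"
      by (simp add: power2_eq_square)
    moreover have "(u * u + [:c:]) * g * g = (u * g) * (u * g) + smult c (g * g)" for u :: "real poly" and c
    proof -
      have "smult c (g * g) = [:c:] * (g * g)" by simp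
      then show ?thesis by (simp only: distrib_left distrib_right mult_ac)
    qed
    ultimately have "h * g = ([:- a, 1:] * g) * ([:- a, 1:] * g) + smult (b^2) (g * g)"
      unfolding hg by (simp only:)
    then have "L (h * g) = L (([:- a, 1:] * g) * ([:- a, 1:] * g)) + b^2 * L (g * g)"
      by (simp only: add smult)
    moreover have "L (h * g) = 0"
      using dh h(2) g0 \<open>h \<noteq> 0\<close> by (intro orth) (simp add: degree_mult_eq)
    moreover have "0 < L (([:- a, 1:] * g) * ([:- a, 1:] * g))"
      using g0 dh degree_mult_eq[of "[:- a, 1:]" g] by (intro pos) auto
    moreover have "0 < L (g * g)" using g0 dh by (intro pos) auto
    ultimately show False by (smt (verit) mult_nonneg_nonneg zero_le_power2)
  qed
qed

text \<open>
  Below degree \<open>2n\<close>, \<open>L p\<close> equals \<open>L\<close> of the remainder of \<open>p\<close> modulo \<open>h\<close>, so it depends only on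
  the values of \<open>p\<close> at the roots of \<open>h\<close>, and Lagrange interpolation gives the weights.
  In degree \<open>2n\<close>, a multiple of \<open>m\<^sup>2\<close> is subtracted first, where \<open>m = t\<^sup>n\<^sup>-\<^sup>d h\<close> is monic of degree \<open>n\<close>
  and vanishes at all nodes; therefore the top coefficient gets the weight \<open>c = L (m\<^sup>2) \<ge> 0\<close>.
\<close>

theorem quadrature:
  obtains R w c where "finite R" "\<And>r. r \<in> R \<Longrightarrow> 0 \<le> w r" "0 \<le> c"
    and "\<And>p. degree p \<le> 2 * n \<Longrightarrow> L p = (\<Sum>r\<in>R. w r * poly p r) + c * coeff p (2 * n)"
proof -
  obtain h where h: "lead_coeff h = 1" "degree h \<le> n"
    and pos: "\<And>q. q \<noteq> 0 \<Longrightarrow> degree q < degree h \<Longrightarrow> 0 < L (q * q)"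
    and orth: "\<And>q. degree (h * q) < 2 * n \<Longrightarrow> L (h * q) = 0"
    using exists_orthogonal_monic by blast
  have h0: "h \<noteq> 0" using h(1) by auto
  define R where "R = {x. poly h x = 0}"
  have cardR: "card R = degree h"
    using orthogonal_has_simple_real_roots[OF h pos orth] by (simp add: R_def)
  have finR: "finite R" using h0 poly_roots_finite by (simp add: R_def)
  obtain l where l_deg: "\<And>r. r \<in> R \<Longrightarrow> degree (l r) < card R"
    and l_val: "\<And>r s. r \<in> R \<Longrightarrow> s \<in> R \<Longrightarrow> poly (l r) s = (if s = r then 1 else 0)"
    using lagrange_interpolation_basis[OF finR] by blast
  define m where "m = monom 1 (n - degree h) * h"
  define w where "w r = L (l r)" for r
  have dm: "degree m = n" "m \<noteq> 0"
    using h h0 by (auto simp: m_def degree_mult_eq degree_monom_eq)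
  have lm: "lead_coeff m = 1" using h by (simp add: m_def lead_coeff_mult degree_monom_eq lead_coeff_monom)
  have m_root: "poly m r = 0" if "r \<in> R" for r using that by (simp add: m_def R_def)
  have dmm: "degree (m * m) = 2 * n" using dm by (simp add: degree_mult_eq)
  have lmm: "coeff (m * m) (2 * n) = 1" using lm dmm lead_coeff_mult[of m m] by simp
  have low: "L p = (\<Sum>r\<in>R. w r * poly p r)" if p: "p = 0 \<or> degree p < 2 * n" for p
  proof -
    define s where "s = p mod h"
    have ps: "p = h * (p div h) + s" by (simp add: s_def)
    have "L (h * (p div h)) = 0"
    proof (cases "p div h = 0")
      case False
      then have "p \<noteq> 0" "degree h \<le> degree p"
        using h0 by (auto simp: div_poly_eq_0_iff)
      have "degree (p div h) \<le> degree p - degree h"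
        using \<open>degree h \<le> degree p\<close> by (intro degree_div_le_diff) simp
      then show ?thesis using False h0 p \<open>p \<noteq> 0\<close> \<open>degree h \<le> degree p\<close>
        by (intro orth) (simp add: degree_mult_eq)
    qed simp
    then have "L p = L s" using ps add by (metis add_0)
    also have "s = (\<Sum>r\<in>R. smult (poly p r) (l r))"
    proof (cases "degree h = 0")
      case True
      then have "R = {}" using cardR finR by simp
      \<comment> \<open>For \<open>h = 1\<close> there are no nodes, and \<open>L\<close> vanishes below degree \<open>2n\<close>.\<close>
      have "s = 0" using degree_mod_less[OF h0, of p] True by (auto simp: s_def)
      then show ?thesis using \<open>R = {}\<close> by simp
    next
      case False
      show ?thesis
      proof (rule poly_eqI_degree[of R])
        fix x assume x: "x \<in> R"
        have "poly s x = poly p x"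
          using x arg_cong[OF ps, of "\<lambda>q. poly q x"] by (simp add: R_def)
        also have "\<dots> = (\<Sum>r\<in>R. if r = x then poly p r else 0)"
          using x finR by simp
        also have "\<dots> = poly (\<Sum>r\<in>R. smult (poly p r) (l r)) x"
          unfolding poly_sum using x by (intro sum.cong) (auto simp: l_val)
        finally show "poly s x = poly (\<Sum>r\<in>R. smult (poly p r) (l r)) x" .
      next
        show "degree s < card R"
          using degree_mod_less[OF h0, of p] False cardR by (auto simp: s_def)
        show "degree (\<Sum>r\<in>R. smult (poly p r) (l r)) < card R"
          using l_deg False cardR
          by (intro degree_sum_less) (auto intro: le_less_trans[OF degree_smult_le])
      qed
    qed
    also have "L \<dots> = (\<Sum>r\<in>R. w r * poly p r)" by (simp add: sum smult w_def mult.commute)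
    finally show ?thesis .
  qed
  show thesis
  proof (rule that[OF finR])
    fix r assume r: "r \<in> R"
    \<comment> \<open>The squares of the Lagrange polynomials have degree less than \<open>2n\<close> and show that the weights are nonnegative.\<close>
    have "degree (l r) < n" using l_deg[OF r] cardR h(2) by simp
    then have "degree (l r * l r) < 2 * n"
      using degree_mult_le[of "l r" "l r"] by simp
    then have "L (l r * l r) = (\<Sum>s\<in>R. w s * poly (l r * l r) s)" by (intro low) simp
    also have "\<dots> = (\<Sum>s\<in>R. if s = r then w s else 0)"
      using r by (intro sum.cong) (auto simp: l_val)
    also have "\<dots> = w r" using r finR by simp
    finally show "0 \<le> w r" using nonneg[of "l r"] \<open>degree (l r) < n\<close> by simp
  next
    show "0 \<le> L (m * m)" using dm by (intro nonneg) simp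
  next
    fix p :: "real poly" assume p: "degree p \<le> 2 * n"
    define a where "a = coeff p (2 * n)"
    define p' where "p' = p - smult a (m * m)"
    have "coeff p' i = 0" if "i \<ge> 2 * n" for i
      using that p dmm lmm by (cases "i = 2 * n") (auto simp: p'_def a_def coeff_eq_0)
    then have "p' = 0 \<or> degree p' < 2 * n"
      by (metis leading_coeff_0_iff not_le)
    then have "L p' = (\<Sum>r\<in>R. w r * poly p r)"
      by (subst low) (auto simp: p'_def m_root intro!: sum.cong)
    moreover have "L p = L p' + a * L (m * m)" by (simp add: p'_def diff smult)
    ultimately show "L p = (\<Sum>r\<in>R. w r * poly p r) + L (m * m) * coeff p (2 * n)"
      by (simp add: a_def)
  qed
qed

end

section \<open>Minors of matrices of rank one\<close>

lemma det_2:
  assumes "A \<in> carrier_mat 2 2"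
  shows "det (A :: 'a::comm_ring_1 mat) = A $$ (0, 0) * A $$ (1, 1) - A $$ (0, 1) * A $$ (1, 0)"
proof -
  have "det (mat_delete A 0 j) = mat_delete A 0 j $$ (0, 0)" for j
    using assms by (intro det_single) (simp add: mat_delete_def)
  then show ?thesis
    using assms laplace_expansion_row[OF assms, of 0]
    by (simp add: cofactor_def mat_delete_def numeral_2_eq_2)
qed

lemma pick_singleton: "pick {i} 0 = i"
  by (auto intro!: Least_equality)

lemma pick_doubleton:
  assumes "i < k" shows "pick {i, k} 0 = i" "pick {i, k} (Suc 0) = k"
proof -
  show *: "pick {i, k} 0 = i" using assms by (auto intro!: Least_equality)
  show "pick {i, k} (Suc 0) = k" unfolding pick.simps(2) * using assms by (auto intro!: Least_equality)
qed

lemma rank_pos_of_nonzero_entry: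
  fixes A :: "'a::field mat"
  assumes "A \<in> carrier_mat m nc" "i < m" "j < nc" "A $$ (i, j) \<noteq> 0"
  shows "1 \<le> vec_space.rank m A"
proof -
  have sel: "{a. a < m \<and> a \<in> {i}} = {i}" "{a. a < nc \<and> a \<in> {j}} = {j}" using assms by auto
  have "submatrix A {i} {j} \<in> carrier_mat 1 1"
    using assms sel by (simp add: submatrix_def)
  then have "det (submatrix A {i} {j}) = A $$ (i, j)"
    using assms sel pick_singleton by (simp add: det_single submatrix_def del: pick.simps)
  then show ?thesis using vec_space.rank_gt_minor[of A m nc "{i}" "{j}"] assms sel by simp
qed

lemma rank_le_1_minor_eq_0:
  fixes A :: "'a::field mat"
  assumes A: "A \<in> carrier_mat m nc" and rank: "vec_space.rank m A \<le> 1"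
    and ik: "i < k" "k < m" and jl: "j < l" "l < nc"
  shows "A $$ (i, j) * A $$ (k, l) = A $$ (i, l) * A $$ (k, j)"
proof (rule ccontr)
  assume ne: "A $$ (i, j) * A $$ (k, l) \<noteq> A $$ (i, l) * A $$ (k, j)"
  have sel: "{a. a < m \<and> a \<in> {i, k}} = {i, k}" "{a. a < nc \<and> a \<in> {j, l}} = {j, l}"
    using assms by auto
  have dims: "dim_row A = m" "dim_col A = nc" using A by auto
  let ?B = "submatrix A {i, k} {j, l}"
  have entry: "?B $$ (a, b) = A $$ (pick {i, k} a, pick {j, l} b)" if "a < 2" "b < 2" for a b
    using that ik jl unfolding submatrix_def dims sel by (simp del: pick.simps)
  have "?B \<in> carrier_mat 2 2"
    using ik jl unfolding submatrix_def dims sel by (simp add: numeral_2_eq_2)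
  then have "det ?B = A $$ (i, j) * A $$ (k, l) - A $$ (i, l) * A $$ (k, j)"
    using pick_doubleton[OF ik(1)] pick_doubleton[OF jl(1)]
    by (simp add: det_2 entry del: pick.simps)
  then have "det ?B \<noteq> 0" using ne by simp
  then show False using vec_space.rank_gt_minor[OF A, of "{i, k}" "{j, l}"] rank ik jl
    unfolding sel by simp
qed

section \<open>Positive semidefinite Hankel matrices\<close>

lemma hankel_mat_carrier: "hankel_mat n l \<in> carrier_mat (n + 1) (n + 1)"
  by (simp add: hankel_mat_def)

lemma hankel_mat_index: "j \<le> n \<Longrightarrow> k \<le> n \<Longrightarrow> hankel_mat n l $$ (j, k) = l $ (j + k)"
  by (simp add: hankel_mat_def)

lemma psd_hankel_iff:
  "positive_semidefinite (hankel_mat n l) \<longleftrightarrow>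
     (\<forall>x. 0 \<le> (\<Sum>j\<le>n. \<Sum>k\<le>n. x j * x k * l $ (j + k)))"
proof -
  have form: "x \<bullet> (hankel_mat n l *\<^sub>v x) = (\<Sum>j\<le>n. \<Sum>k\<le>n. x $ j * x $ k * l $ (j + k))"
    if "x \<in> carrier_vec (n + 1)" for x
    using that
    by (simp add: scalar_prod_def hankel_mat_def sum_distrib_left mult_ac
        atLeast0LessThan lessThan_Suc_atMost)
  have "transpose_mat (hankel_mat n l) = hankel_mat n l"
    by (rule eq_matI) (simp_all add: hankel_mat_def add.commute)
  then have "positive_semidefinite (hankel_mat n l) \<longleftrightarrow>
     (\<forall>x \<in> carrier_vec (n + 1). 0 \<le> (\<Sum>j\<le>n. \<Sum>k\<le>n. x $ j * x $ k * l $ (j + k)))"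
    unfolding positive_semidefinite_def using form by (simp add: hankel_mat_def)
  also have "\<dots> \<longleftrightarrow> (\<forall>x. 0 \<le> (\<Sum>j\<le>n. \<Sum>k\<le>n. x j * x k * l $ (j + k)))" (is "?V \<longleftrightarrow> ?F")
  proof
    assume V: ?V
    show ?F
    proof
      fix x
      show "0 \<le> (\<Sum>j\<le>n. \<Sum>k\<le>n. x j * x k * l $ (j + k))"
        using bspec[OF V, of "vec (n + 1) x"] by simp
    qed
  qed blast
  finally show ?thesis .
qed

section \<open>The moment curve\<close>

lemma even_moment_curve_eq:
  "even_moment_curve n = {moment_map (2 * n) x y | x y. x^2 + y^2 = 1}"
proof (intro equalityI subsetI)
  fix l assume "l \<in> {moment_map (2 * n) x y | x y. x^2 + y^2 = 1}"
  then obtain x y where l: "l = moment_map (2 * n) x y" and xy: "x^2 + y^2 = 1" by blast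
  obtain t where "0 \<le> t" "t < 2 * pi" "x = cos t" "y = sin t" using sincos_total_2pi[OF xy] .
  then show "l \<in> even_moment_curve n" unfolding even_moment_curve_def l by auto
qed (force simp: even_moment_curve_def)

lemma moment_map_carrier: "moment_map d x y \<in> carrier_vec (d + 1)"
  by (simp add: moment_map_def)

lemma moment_map_index: "i \<le> d \<Longrightarrow> moment_map d x y $ i = x ^ (d - i) * y ^ i"
  by (simp add: moment_map_def)

lemma moment_map_index_add:
  "j \<le> n \<Longrightarrow> k \<le> n \<Longrightarrow> moment_map (2 * n) x y $ (j + k) = (x ^ (n - j) * y ^ j) * (x ^ (n - k) * y ^ k)"
proof -
  assume "j \<le> n" "k \<le> n"
  then have exponent: "2 * n - (j + k) = (n - j) + (n - k)" by simp
  have "moment_map (2 * n) x y $ (j + k) = x ^ (2 * n - (j + k)) * y ^ (j + k)"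
    using \<open>j \<le> n\<close> \<open>k \<le> n\<close> by (intro moment_map_index) simp
  then show ?thesis unfolding exponent power_add by simp
qed

lemma moment_map_hankel_psd: "positive_semidefinite (hankel_mat n (moment_map (2 * n) x y))"
proof -
  have "(\<Sum>j\<le>n. \<Sum>k\<le>n. u j * u k * moment_map (2 * n) x y $ (j + k)) =
      (\<Sum>j\<le>n. u j * (x ^ (n - j) * y ^ j))^2" for u
    unfolding power2_eq_square sum_product
    by (intro sum.cong refl) (subst moment_map_index_add; simp add: mult_ac)
  then show ?thesis unfolding psd_hankel_iff by simp
qed

lemma moment_map_trace:
  "(\<Sum>j=0..n. real (n choose j) * moment_map (2 * n) x y $ (2 * j)) = (x^2 + y^2) ^ n"
proof -
  have "moment_map (2 * n) x y $ (2 * j) = (y^2) ^ j * (x^2) ^ (n - j)" if "j \<le> n" for j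
    using moment_map_index_add[OF that that, of x y]
    by (simp add: mult_2 power_mult_distrib power2_eq_square flip: power_add)
       (simp add: power_add)
  then show ?thesis
    unfolding add.commute[of "x^2"] binomial_ring atLeast0AtMost
    by (intro sum.cong) (simp_all add: mult_ac)
qed

text \<open>
  The geometric progression with ratio \<open>r\<close> is the moment vector of the affine point \<open>(1, r)\<close>; the
  denominator normalises this point to the unit circle.
\<close>

lemma geometric_in_curve:
  assumes l: "l \<in> carrier_vec (2 * n + 1)" "\<And>i. i \<le> 2 * n \<Longrightarrow> l $ i = r ^ i / (1 + r^2) ^ n"
  shows "l \<in> even_moment_curve n"
proof -
  define s where "s = sqrt (1 + r^2)"
  have pos: "0 < 1 + r^2" by (simp add: add_pos_nonneg)
  then have s: "s^2 = 1 + r^2" "s \<noteq> 0" by (simp_all add: s_def)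
  have "l = moment_map (2 * n) (1 / s) (r / s)"
  proof (rule eq_vecI)
    fix i assume "i < dim_vec (moment_map (2 * n) (1 / s) (r / s))"
    then have i: "i \<le> 2 * n" by (simp add: moment_map_def)
    have "s ^ (2 * n - i) * s ^ i = (s^2) ^ n" using i by (simp flip: power_add power_mult)
    then have "(1 + r^2) ^ n = s ^ (2 * n - i) * s ^ i" using s by simp
    then show "l $ i = moment_map (2 * n) (1 / s) (r / s) $ i"
      using i s by (simp add: l moment_map_index power_divide)
  qed (use l in \<open>simp add: moment_map_def\<close>)
  moreover have "(1 / s)^2 + (r / s)^2 = 1"
    using s pos by (simp add: power_divide flip: add_divide_distrib)
  ultimately show ?thesis unfolding even_moment_curve_eq by blast
qed

text \<open>
  The point \<open>(0, 1)\<close> of the circle, the point at infinity of the affine chart \<open>(1, r)\<close>.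
\<close>

lemma unit_vec_in_curve: "unit_vec (2 * n + 1) (2 * n) \<in> even_moment_curve n"
proof -
  have "unit_vec (2 * n + 1) (2 * n) = moment_map (2 * n) (0::real) 1"
    by (rule eq_vecI) (auto simp: moment_map_def power_0_left)
  then show ?thesis unfolding even_moment_curve_eq by force
qed

lemma curve_rank_one:
  assumes l: "l \<in> even_moment_curve n"
  shows "vec_space.rank (n + 1) (hankel_mat n l) = 1"
proof (rule antisym)
  obtain x y where l: "l = moment_map (2 * n) x y" and xy: "x^2 + y^2 = 1"
    using l unfolding even_moment_curve_eq by blast
  show "vec_space.rank (n + 1) (hankel_mat n l) \<le> 1"
    by (rule vec_space.rank_le_1_product_entries[OF hankel_mat_carrier,
          of n l "\<lambda>j. x ^ (n - j) * y ^ j" "\<lambda>j. x ^ (n - j) * y ^ j"])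
      (simp add: hankel_mat_def l moment_map_index_add)
  have "\<exists>j\<le>n. l $ (2 * j) \<noteq> 0"
  proof (rule ccontr)
    assume "\<not> ?thesis"
    then show False using moment_map_trace[of n x y] xy by (simp add: l)
  qed
  then obtain j where "j \<le> n" "l $ (j + j) \<noteq> 0" by (auto simp: mult_2)
  then show "1 \<le> vec_space.rank (n + 1) (hankel_mat n l)"
    by (intro rank_pos_of_nonzero_entry[OF hankel_mat_carrier, of j n j]) (simp_all add: hankel_mat_index)
qed

text \<open>
  The minor with rows \<open>0, j\<close> and columns \<open>0, k\<close> says \<open>l\<^sub>0 l\<^sub>j\<^sub>+\<^sub>k = l\<^sub>j l\<^sub>k\<close>, so \<open>l\<close> is geometric when
  \<open>l\<^sub>0 \<noteq> 0\<close>. The minor with rows and columns \<open>j, k\<close> says \<open>l\<^sub>j\<^sub>+\<^sub>k\<^sup>2 = l\<^sub>2\<^sub>j l\<^sub>2\<^sub>k\<close>, which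
  spreads the zero from \<open>l\<^sub>0\<close> to all entries except \<open>l\<^sub>2\<^sub>n\<close>.
\<close>

lemma rank_one_hankel_in_curve:
  assumes l: "l \<in> carrier_vec (2 * n + 1)"
    and rank: "vec_space.rank (n + 1) (hankel_mat n l) = 1"
    and trace: "(\<Sum>j=0..n. real (n choose j) * l $ (2 * j)) = 1"
  shows "l \<in> even_moment_curve n"
proof -
  have minor: "l $ (i + j) * l $ (k + m) = l $ (i + m) * l $ (k + j)"
    if "i < k" "k \<le> n" "j < m" "m \<le> n" for i j k m
    using rank_le_1_minor_eq_0[OF hankel_mat_carrier _ that(1) _ that(3), of n l] rank that
    by (simp add: hankel_mat_index)
  show ?thesis
  proof (cases "l $ 0 = 0")
    case False
    define r where "r = l $ 1 / l $ 0"
    have step: "l $ 0 * l $ (j + k) = l $ j * l $ k" if "j \<le> n" "k \<le> n" for j k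
      using minor[of 0 j 0 k] that by (cases "j = 0 \<or> k = 0") (auto simp: mult.commute)
    have low: "l $ i = l $ 0 * r ^ i" if "i \<le> n" for i
      using that
    proof (induction i)
      case (Suc i)
      have "l $ Suc i = r * l $ i"
        using step[of 1 i] Suc.prems False by (simp add: r_def field_simps)
      then show ?case using Suc by simp
    qed simp
    have geom: "l $ i = l $ 0 * r ^ i" if "i \<le> 2 * n" for i
    proof -
      define j k where "j = min i n" and "k = i - j"
      have "i = j + k" "j \<le> n" "k \<le> n" using that by (auto simp: j_def k_def)
      then show ?thesis using step[of j k] low[of j] low[of k] False by (simp add: power_add)
    qed
    have "1 = (\<Sum>j=0..n. real (n choose j) * (l $ 0 * (r^2) ^ j))"
      unfolding trace[symmetric]
    proof (intro sum.cong refl)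
      fix j assume "j \<in> {0..n}"
      then show "real (n choose j) * l $ (2 * j) = real (n choose j) * (l $ 0 * (r^2) ^ j)"
        using geom[of "2 * j"] by (simp only: power_mult) simp
    qed
    also have "\<dots> = l $ 0 * (r^2 + 1) ^ n"
      unfolding binomial_ring atLeast0AtMost by (simp add: sum_distrib_left mult_ac)
    finally have scale: "l $ 0 * (1 + r^2) ^ n = 1" by (simp add: add.commute)
    have "1 + r^2 \<noteq> 0" using scale by (auto simp: power_0_left add_nonneg_eq_0_iff)
    show ?thesis
    proof (rule geometric_in_curve[OF l])
      fix i assume "i \<le> 2 * n"
      then show "l $ i = r ^ i / (1 + r^2) ^ n"
        using geom[of i] arg_cong[OF scale, of "\<lambda>t. t * r ^ i"] \<open>1 + r^2 \<noteq> 0\<close>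
        by (simp add: eq_divide_eq mult_ac)
    qed
  next
    case True
    have zero: "l $ i = 0" if "i < 2 * n" for i
      using that
    proof (induction i rule: less_induct)
      case (less i)
      show ?case
      proof (cases "i = 0")
        case False
        \<comment> \<open>The choice \<open>j < k\<close> makes \<open>2 j < i\<close>, so that the induction hypothesis applies to \<open>l\<^sub>2\<^sub>j\<close>.\<close>
        define j k where "j = i - min i n" and "k = min i n"
        have jk: "i = j + k" "j < k" "k \<le> n" using less.prems False by (auto simp: j_def k_def)
        then have "l $ (j + j) = 0" using less by (cases "j + j < 2 * n") auto
        then show ?thesis using minor[of j k j k] jk by (simp add: add.commute)
      qed (use True in simp)
    qed
    have "(\<Sum>j=0..n. real (n choose j) * l $ (2 * j)) = (\<Sum>j=0..n. if j = n then l $ (2 * n) else 0)"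
      by (intro sum.cong) (auto simp: zero)
    then have "l $ (2 * n) = 1" using trace by simp
    then have "l = unit_vec (2 * n + 1) (2 * n)"
      using l zero by (intro eq_vecI) (auto simp: less_Suc_eq)
    then show ?thesis using unit_vec_in_curve by simp
  qed
qed

section \<open>The convex hull of the moment curve\<close>

text \<open>
  Convexity only speaks of two points; one point is split off and the weights of the others are
  rescaled to have sum one again.
\<close>

lemma convex_combination_mem:
  assumes C: "convex_vec d C" and "finite I" "I \<noteq> {}"
    and "\<And>i. i \<in> I \<Longrightarrow> 0 \<le> a i" "\<And>i. i \<in> I \<Longrightarrow> x i \<in> C" "(\<Sum>i\<in>I. a i) = 1"
  shows "vec d (\<lambda>j. \<Sum>i\<in>I. a i * x i $ j) \<in> C"
  using assms(2-)
proof (induction I arbitrary: a rule: finite_ne_induct)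
  case (singleton i)
  have "x i \<in> carrier_vec d" using C singleton by (auto simp: convex_vec_def)
  then have "vec d (\<lambda>j. x i $ j) = x i" by (intro eq_vecI) auto
  then show ?case using singleton by simp
next
  case (insert k I)
  have car: "\<And>i. i \<in> insert k I \<Longrightarrow> x i \<in> carrier_vec d"
    using C insert.prems(2) by (auto simp: convex_vec_def)
  have sum_I: "(\<Sum>i\<in>I. a i) = 1 - a k" using insert by simp
  show ?case
  proof (cases "a k = 1")
    case True
    then have "\<forall>i\<in>I. a i = 0"
      using sum_I insert.hyps insert.prems(1) sum_nonneg_eq_0_iff[of I a] by simp
    then have "vec d (\<lambda>j. \<Sum>i\<in>insert k I. a i * x i $ j) = x k"
      using insert.hyps True car[of k] by (intro eq_vecI) auto
    then show ?thesis using insert.prems by simp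
  next
    case False
    have ak: "0 \<le> a k" "0 < 1 - a k"
      using False insert.prems(1)[of k] sum_I sum_nonneg[of I a] insert.prems(1) by fastforce+
    define y where "y = vec d (\<lambda>j. \<Sum>i\<in>I. a i / (1 - a k) * x i $ j)"
    have "y \<in> C" unfolding y_def
      using insert.prems ak sum_I by (intro insert.IH) (auto simp flip: sum_divide_distrib)
    then have "a k \<cdot>\<^sub>v x k + (1 - a k) \<cdot>\<^sub>v y \<in> C"
      using C insert.prems(2)[of k] ak unfolding convex_vec_def by auto
    also have "a k \<cdot>\<^sub>v x k + (1 - a k) \<cdot>\<^sub>v y = vec d (\<lambda>j. \<Sum>i\<in>insert k I. a i * x i $ j)"
      using insert.hyps car[of k] ak by (intro eq_vecI) (auto simp: y_def sum_distrib_left)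
    finally show ?thesis .
  qed
qed

lemma convex_psd_hankel:
  "convex_vec (2 * n + 1) {l \<in> carrier_vec (2 * n + 1). positive_semidefinite (hankel_mat n l) \<and>
     (\<Sum>j=0..n. real (n choose j) * l $ (2 * j)) = 1}"
  unfolding convex_vec_def
proof (intro conjI ballI allI impI)
  fix l m :: "real vec" and u v :: real
  assume lm: "l \<in> {l \<in> carrier_vec (2 * n + 1). positive_semidefinite (hankel_mat n l) \<and>
     (\<Sum>j=0..n. real (n choose j) * l $ (2 * j)) = 1}"
    "m \<in> {l \<in> carrier_vec (2 * n + 1). positive_semidefinite (hankel_mat n l) \<and>
     (\<Sum>j=0..n. real (n choose j) * l $ (2 * j)) = 1}"
    and uv: "0 \<le> u" "0 \<le> v" "u + v = 1"
  let ?c = "u \<cdot>\<^sub>v l + v \<cdot>\<^sub>v m"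
  have idx: "?c $ i = u * l $ i + v * m $ i" if "i \<le> 2 * n" for i
    using lm that carrier_vecD[of l] carrier_vecD[of m] by auto
  have "(\<Sum>j\<le>n. \<Sum>k\<le>n. x j * x k * ?c $ (j + k)) =
      u * (\<Sum>j\<le>n. \<Sum>k\<le>n. x j * x k * l $ (j + k)) + v * (\<Sum>j\<le>n. \<Sum>k\<le>n. x j * x k * m $ (j + k))" for x
    unfolding sum_distrib_left sum.distrib[symmetric]
    by (intro sum.cong refl) (subst idx; simp add: algebra_simps)
  then have "positive_semidefinite (hankel_mat n ?c)"
    using lm uv by (simp add: psd_hankel_iff)
  moreover have "(\<Sum>j=0..n. real (n choose j) * ?c $ (2 * j)) =
      u * (\<Sum>j=0..n. real (n choose j) * l $ (2 * j)) + v * (\<Sum>j=0..n. real (n choose j) * m $ (2 * j))"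
    unfolding sum_distrib_left sum.distrib[symmetric]
    by (intro sum.cong refl) (subst idx; simp add: algebra_simps)
  ultimately show "?c \<in> {l \<in> carrier_vec (2 * n + 1). positive_semidefinite (hankel_mat n l) \<and>
     (\<Sum>j=0..n. real (n choose j) * l $ (2 * j)) = 1}"
    using lm uv by auto
qed auto

text \<open>
  The Riesz functional of \<open>l\<close>, which sends \<open>t\<^sup>i\<close> to \<open>l\<^sub>i\<close>. Coefficients above index \<open>2n\<close> are ignored,
  which makes it linear on all polynomials.
\<close>

definition hankel_functional :: "nat \<Rightarrow> real vec \<Rightarrow> real poly \<Rightarrow> real" where
  "hankel_functional n l p = (\<Sum>i\<le>2 * n. coeff p i * l $ i)"

lemma hankel_functional_monom:
  "i \<le> 2 * n \<Longrightarrow> hankel_functional n l (monom a i) = a * l $ i"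
proof -
  assume i: "i \<le> 2 * n"
  have "hankel_functional n l (monom a i) = (\<Sum>k\<le>2 * n. if k = i then a * l $ i else 0)"
    unfolding hankel_functional_def by (intro sum.cong) auto
  then show ?thesis using i by simp
qed

lemma hankel_functional_sum:
  "hankel_functional n l (\<Sum>a\<in>A. f a) = (\<Sum>a\<in>A. hankel_functional n l (f a))"
  unfolding hankel_functional_def coeff_sum sum_distrib_right by (rule sum.swap)

lemma hankel_functional_square:
  assumes "degree p \<le> n"
  shows "hankel_functional n l (p * p) = (\<Sum>j\<le>n. \<Sum>k\<le>n. coeff p j * coeff p k * l $ (j + k))"
proof -
  have p: "p = (\<Sum>j\<le>n. monom (coeff p j) j)"
    using poly_as_sum_of_monoms'[OF assms] by simp
  have "p * p = (\<Sum>j\<le>n. \<Sum>k\<le>n. monom (coeff p j * coeff p k) (j + k))"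
    by (subst (1 2) p) (simp add: sum_product mult_monom)
  then show ?thesis
    by (simp add: hankel_functional_sum hankel_functional_monom)
qed

lemma pos_functional_hankel:
  assumes "positive_semidefinite (hankel_mat n l)"
  shows "pos_functional (hankel_functional n l) n"
proof
  show "hankel_functional n l (p + q) = hankel_functional n l p + hankel_functional n l q" for p q
    by (simp add: hankel_functional_def distrib_right sum.distrib)
  show "hankel_functional n l (Polynomial.smult a p) = a * hankel_functional n l p" for a p
    by (simp add: hankel_functional_def sum_distrib_left mult.assoc)
  show "0 \<le> hankel_functional n l (p * p)" if "degree p \<le> n" for p
    using assms that by (simp add: hankel_functional_square psd_hankel_iff)
qed

text \<open>
  Applied to the monomials \<open>t\<^sup>j\<close>, the quadrature formula writes \<open>l\<close> in terms of the vectors \<open>(r\<^sup>j)\<^sub>j\<close>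
  and the last unit vector. The latter lies on the curve, and the former become points of the curve
  when the factors \<open>(1 + r\<^sup>2)\<^sup>n\<close> are moved into the weights. The linear equation at \<open>l\<close> and at these points
  then shows that the weights have sum one.
\<close>

lemma psd_hankel_in_hull:
  assumes l: "l \<in> carrier_vec (2 * n + 1)" and psd: "positive_semidefinite (hankel_mat n l)"
    and trace: "(\<Sum>j=0..n. real (n choose j) * l $ (2 * j)) = 1"
  shows "l \<in> convex_vec (2 * n + 1) hull even_moment_curve n"
proof -
  interpret pos_functional "hankel_functional n l" n using psd by (rule pos_functional_hankel)
  obtain R w c where R: "finite R" "\<And>r. r \<in> R \<Longrightarrow> 0 \<le> w r" "0 \<le> c"
    and quad: "\<And>p. degree p \<le> 2 * n \<Longrightarrow>
      hankel_functional n l p = (\<Sum>r\<in>R. w r * poly p r) + c * coeff p (2 * n)"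
    using quadrature by blast
  \<comment> \<open>The index \<open>None\<close> stands for the node at infinity.\<close>
  define I where "I = insert None (Some ` R)"
  define a :: "real option \<Rightarrow> real" where "a = (\<lambda>None \<Rightarrow> c | Some r \<Rightarrow> w r * (1 + r^2) ^ n)"
  define x :: "real option \<Rightarrow> real vec" where "x = (\<lambda>None \<Rightarrow> unit_vec (2 * n + 1) (2 * n)
      | Some r \<Rightarrow> vec (2 * n + 1) (\<lambda>i. r ^ i / (1 + r^2) ^ n))"
  have x_curve: "x i \<in> even_moment_curve n" for i
  proof (cases i)
    case None
    then show ?thesis by (simp add: x_def unit_vec_in_curve[simplified])
  next
    case (Some r)
    then show ?thesis by (intro geometric_in_curve[of _ _ r]) (simp_all add: x_def)
  qed
  have a_nonneg: "0 \<le> a i" if "i \<in> I" for i using R that by (auto simp: I_def a_def)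
  have pos: "1 + r^2 \<noteq> 0" for r :: real by (smt (verit) zero_le_power2)
  have sum_I: "(\<Sum>i\<in>I. f i) = f None + (\<Sum>r\<in>R. f (Some r))" for f :: "real option \<Rightarrow> real"
    using R(1) by (simp add: I_def sum.reindex)
  have entry: "l $ j = (\<Sum>i\<in>I. a i * x i $ j)" if "j \<le> 2 * n" for j
  proof -
    have "l $ j = (\<Sum>r\<in>R. w r * r ^ j) + c * (if j = 2 * n then 1 else 0)"
      using quad[of "monom 1 j"] hankel_functional_monom[OF that, of l 1] that
      by (simp add: degree_monom_eq poly_monom)
    then show ?thesis
      using that pos by (simp add: sum_I a_def x_def add.commute)
  qed
  have "1 = (\<Sum>j=0..n. real (n choose j) * (\<Sum>i\<in>I. a i * x i $ (2 * j)))"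
    unfolding trace[symmetric] by (intro sum.cong) (simp_all add: entry)
  also have "\<dots> = (\<Sum>i\<in>I. a i * (\<Sum>j=0..n. real (n choose j) * x i $ (2 * j)))"
    unfolding sum_distrib_left by (subst sum.swap) (simp add: mult_ac)
  also have "\<dots> = (\<Sum>i\<in>I. a i)"
  proof (intro sum.cong refl)
    fix i
    obtain u v where "x i = moment_map (2 * n) u v" "u^2 + v^2 = 1"
      using x_curve[of i] unfolding even_moment_curve_eq by blast
    then show "a i * (\<Sum>j=0..n. real (n choose j) * x i $ (2 * j)) = a i"
      by (simp add: moment_map_trace)
  qed
  finally have sum_a: "(\<Sum>i\<in>I. a i) = 1" by simp
  have "l = vec (2 * n + 1) (\<lambda>j. \<Sum>i\<in>I. a i * x i $ j)"
    using l by (intro eq_vecI) (auto simp: entry)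
  moreover have "\<dots> \<in> C" if "convex_vec (2 * n + 1) C" "even_moment_curve n \<subseteq> C" for C
    using that R(1) x_curve a_nonneg sum_a
    by (intro convex_combination_mem[OF that(1)]) (auto simp: I_def)
  ultimately show ?thesis unfolding hull_def by auto
qed

theorem theorem5p6:
  fixes n :: nat
  assumes "n \<ge> 1"
  shows "even_moment_curve n =
           {l \<in> carrier_vec (2 * n + 1).
              vec_space.rank (n + 1) (hankel_mat n l) = 1 \<and>
              positive_semidefinite (hankel_mat n l) \<and>
              (\<Sum>j = 0..n. real (n choose j) * l $ (2 * j)) = 1}
       \<and> convex_vec (2 * n + 1) hull even_moment_curve n =
           {l \<in> carrier_vec (2 * n + 1).
              positive_semidefinite (hankel_mat n l) \<and>
              (\<Sum>j = 0..n. real (n choose j) * l $ (2 * j)) = 1}"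
    (is "_ = ?rank_one \<and> _ = ?spectrahedron")
proof
  have curve: "l \<in> ?spectrahedron" if l: "l \<in> even_moment_curve n" for l
  proof -
    obtain x y where "l = moment_map (2 * n) x y" "x^2 + y^2 = 1"
      using l unfolding even_moment_curve_eq by blast
    then show ?thesis
      using moment_map_carrier[of "2 * n" x y] moment_map_hankel_psd[of n x y] moment_map_trace[of n x y]
      by simp
  qed
  then show "even_moment_curve n = ?rank_one"
    using curve_rank_one rank_one_hankel_in_curve by blast
  show "convex_vec (2 * n + 1) hull even_moment_curve n = ?spectrahedron"
  proof
    show "convex_vec (2 * n + 1) hull even_moment_curve n \<subseteq> ?spectrahedron"
      using curve by (intro hull_minimal convex_psd_hankel) blast
    show "?spectrahedron \<subseteq> convex_vec (2 * n + 1) hull even_moment_curve n"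
      using psd_hankel_in_hull by blast
  qed
qed

end
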